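(* Let $n\geq 1$ and let $A\colon J\to\mathbb{R}^{n\times n}$ be a smooth function on an open interval $J=(\alpha,\beta)\subseteq\mathbb{R}$. Then for each $t_0\in J$ and each $v_0\in\mathbb{R}^n$ the nonautonomous linear ordinary differential equation \[ \dot x(t)=A(t)\cdot x(t),\qquad x(t_0)=v_0 \] has a unique smooth solution $x\colon J\to\mathbb{R}^n$ (defined on all of $J$).
   Context: $\mathbb{R}^{n\times n}$ denotes the space of real $n\times n$ matrices. *)

theory Defs
  imports "HOL-Analysis.Analysis"
begin

text \<open>
  Smoothness (of class \<open>C\<^sup>\<infinity>\<close>) of a function of one real variable: all iterated derivatives exist on \<open>S\<close>.
  Derivatives are two-sided, so this is the usual notion only for open \<open>S\<close>; there it depends
  only on the values of \<open>f\<close> on \<open>S\<close>.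
\<close>

definition smooth_on :: "real set \<Rightarrow> (real \<Rightarrow> 'a::real_normed_vector) \<Rightarrow> bool" where
  "smooth_on S f \<longleftrightarrow>
     (\<forall>k. \<forall>t\<in>S. ((\<lambda>g s. vector_derivative g (at s)) ^^ k) f differentiable (at t))"

end

theory Submission
  imports Defs
begin

text \<open>
  The solution is the sum of the Picard series \<open>\<Sum>k. d k\<close>, where \<open>d 0 = v\<^sub>0\<close> and \<open>d (k + 1)\<close> is the
  antiderivative of \<open>A d k\<close> vanishing at \<open>t\<^sub>0\<close>. On compact subintervals \<open>d k\<close> is dominated by
  \<open>C (M \<bar>t - t\<^sub>0\<bar>)\<^sup>k / k!\<close>, so the series may be differentiated termwise. The difference \<open>z\<close> of two
  solutions satisfies the same recursion with \<open>d k = z\<close> for all \<open>k\<close>, so the same bound forces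
  \<open>z = 0\<close>. Smoothness of a solution follows by bootstrapping in the equation.
\<close>

section \<open>Picard iterates and their series\<close>

text \<open>Induction on \<open>k\<close>: along the segment from \<open>t\<^sub>0\<close> to
  \<open>t\<close>, the estimate for \<open>d k\<close> bounds the derivative of
  \<open>d (Suc k)\<close> by that of the next majorant, and the mean value inequality integrates
  this. Only the recursion ties the \<open>d k\<close> together, so both Picard iterates and a
  constant sequence are covered.\<close>

lemma picard_iterate_bound:
  fixes d :: "nat \<Rightarrow> real \<Rightarrow> 'a::real_normed_vector"
  assumes T: "convex T" "t\<^sub>0 \<in> T"
    and deriv: "\<And>k s. s \<in> T \<Longrightarrow> (d (Suc k) has_vector_derivative L s (d k s)) (at s)"
    and L: "\<And>s v. s \<in> T \<Longrightarrow> norm (L s v) \<le> M * norm v"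
    and M: "0 \<le> M"
    and init: "\<And>k. d (Suc k) t\<^sub>0 = 0"
    and bound: "\<And>s. s \<in> T \<Longrightarrow> norm (d 0 s) \<le> C"
    and t: "t \<in> T"
  shows "norm (d k t) \<le> C * (M * \<bar>t - t\<^sub>0\<bar>) ^ k / fact k"
  using t
proof (induction k arbitrary: t)
  case 0
  then show ?case using bound by simp
next
  case (Suc k)
  \<comment> \<open>Parametrising the segment by \<open>{0..1}\<close> treats points on either side
    of \<open>t\<^sub>0\<close> alike.\<close>
  define p where "p s = t\<^sub>0 + s * (t - t\<^sub>0)" for s
  define c where "c = M * \<bar>t - t\<^sub>0\<bar>"
  have p: "p s \<in> T" if "0 \<le> s" "s \<le> 1" for s
    using convexD_alt[OF T(1) T(2) Suc.prems, of s] that by (simp add: p_def algebra_simps)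
  have pd: "(p has_vector_derivative (t - t\<^sub>0)) (at s)" for s
    unfolding p_def by (auto intro!: derivative_eq_intros)
  have dd: "(d (Suc k) \<circ> p has_vector_derivative (t - t\<^sub>0) *\<^sub>R L (p s) (d k (p s))) (at s)"
    if "0 \<le> s" "s \<le> 1" for s
    by (rule vector_diff_chain_at[OF pd deriv[OF p[OF that]]])
  \<comment> \<open>This majorant vanishes at 0 and is the claimed bound at 1; on differentiation
    the factor \<open>Suc k\<close> cancels against \<open>fact (Suc k)\<close>.\<close>
  have phi: "((\<lambda>s. C * (c * s) ^ Suc k / fact (Suc k)) has_vector_derivative C * c * (c * s) ^ k / fact k) (at s)" for s
    unfolding has_real_derivative_iff_has_vector_derivative[symmetric]
    by (rule derivative_eq_intros refl | simp add: field_simps del: of_nat_Suc)+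
  have "norm ((d (Suc k) \<circ> p) 1 - (d (Suc k) \<circ> p) 0)
      \<le> C * (c * 1) ^ Suc k / fact (Suc k) - C * (c * 0) ^ Suc k / fact (Suc k)"
  proof (rule differentiable_bound_general[OF _ _ _ dd phi])
    show "continuous_on {0..1} (d (Suc k) \<circ> p)"
      using dd by (intro continuous_at_imp_continuous_on ballI has_vector_derivative_continuous) auto
    show "continuous_on {0..1} (\<lambda>s. C * (c * s) ^ Suc k / fact (Suc k))"
      by (intro continuous_intros) simp
    fix s :: real
    assume s: "0 < s" "s < 1"
    have "norm (L (p s) (d k (p s))) \<le> M * norm (d k (p s))"
      using L p s by auto
    also have "\<dots> \<le> M * (C * (M * \<bar>p s - t\<^sub>0\<bar>) ^ k / fact k)"
      using s M by (intro mult_left_mono Suc.IH p) auto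
    also have "M * \<bar>p s - t\<^sub>0\<bar> = c * s"
      using s by (simp add: p_def c_def abs_mult)
    finally have "\<bar>t - t\<^sub>0\<bar> * norm (L (p s) (d k (p s))) \<le> \<bar>t - t\<^sub>0\<bar> * (M * (C * (c * s) ^ k / fact k))"
      by (intro mult_left_mono) auto
    then show "norm ((t - t\<^sub>0) *\<^sub>R L (p s) (d k (p s))) \<le> C * c * (c * s) ^ k / fact k"
      unfolding norm_scaleR real_norm_def by (simp add: c_def ac_simps)
  qed auto
  then show ?case
    by (simp add: p_def c_def init)
qed

lemma summable_picard_majorant: "summable (\<lambda>k. C * c ^ k / fact k)" for c C :: real
  using summable_mult[OF summable_exp[of c], of C] by (simp add: field_simps)

text \<open>A substitute for Gronwall's inequality: with \<open>d k = z\<close> the Picard bound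
  holds for every \<open>k\<close>, and its right-hand side is the general term of a convergent
  exponential series, hence tends to 0.\<close>

lemma linear_ode_zero:
  fixes z :: "real \<Rightarrow> 'a::real_normed_vector"
  assumes T: "convex T" "t\<^sub>0 \<in> T"
    and deriv: "\<And>s. s \<in> T \<Longrightarrow> (z has_vector_derivative L s (z s)) (at s)"
    and L: "\<And>s v. s \<in> T \<Longrightarrow> norm (L s v) \<le> M * norm v"
    and M: "0 \<le> M"
    and init: "z t\<^sub>0 = 0"
    and bound: "\<And>s. s \<in> T \<Longrightarrow> norm (z s) \<le> C"
    and t: "t \<in> T"
  shows "z t = 0"
proof -
  have "norm (z t) \<le> C * (M * \<bar>t - t\<^sub>0\<bar>) ^ k / fact k" for k
    by (rule picard_iterate_bound[of T t\<^sub>0 "\<lambda>_. z" L, OF T deriv L M init bound t])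
  then have "norm (z t) \<le> 0"
    by (intro LIMSEQ_le_const[OF summable_LIMSEQ_zero[OF summable_picard_majorant]]) auto
  then show ?thesis by simp
qed

text \<open>Since \<open>T\<close> is bounded, one majorant serves all its points, and the
  Weierstrass test makes the series of derivatives converge uniformly. Each \<open>L s\<close> is
  linear and continuous, so it can be pulled out of the sum.\<close>

lemma picard_series_has_vector_derivative:
  fixes d :: "nat \<Rightarrow> real \<Rightarrow> 'a::banach"
  assumes T: "open T" "convex T" "bounded T" "t\<^sub>0 \<in> T"
    and deriv: "\<And>k s. s \<in> T \<Longrightarrow> (d (Suc k) has_vector_derivative L s (d k s)) (at s)"
    and lin: "\<And>s. s \<in> T \<Longrightarrow> bounded_linear (L s)"
    and L: "\<And>s v. s \<in> T \<Longrightarrow> norm (L s v) \<le> M * norm v"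
    and M: "0 \<le> M"
    and init: "\<And>k. d (Suc k) t\<^sub>0 = 0"
    and d0: "d 0 = (\<lambda>_. v)"
    and t: "t \<in> T"
  shows "((\<lambda>s. \<Sum>k. d k s) has_vector_derivative L t (\<Sum>k. d k t)) (at t)"
proof -
  obtain R where R: "\<bar>s - t\<^sub>0\<bar> \<le> R" if "s \<in> T" for s
    using \<open>bounded T\<close> by (metis bounded_any_center dist_real_def dist_commute)
  have d_le: "norm (d k s) \<le> norm v * (M * R) ^ k / fact k" if "s \<in> T" for k s
  proof -
    have "norm (d k s) \<le> norm v * (M * \<bar>s - t\<^sub>0\<bar>) ^ k / fact k"
      by (rule picard_iterate_bound[where d = d and L = L, OF T(2,4) deriv L M init _ that]) (auto simp: d0)
    also have "\<dots> \<le> norm v * (M * R) ^ k / fact k"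
      using M R[OF that] by (intro divide_right_mono mult_left_mono power_mono) auto
    finally show ?thesis .
  qed
  have summable: "summable (\<lambda>k. d k s)" if "s \<in> T" for s
    by (rule summable_comparison_test'[OF summable_picard_majorant d_le[OF that]])
  have unif: "uniform_limit T (\<lambda>n s. \<Sum>i<n. L s (d i s)) (\<lambda>s. L s (\<Sum>k. d k s)) sequentially"
  proof -
    have "uniform_limit T (\<lambda>n s. \<Sum>i<n. L s (d i s)) (\<lambda>s. \<Sum>i. L s (d i s)) sequentially"
    proof (rule Weierstrass_m_test)
      show "norm (L s (d k s)) \<le> M * (norm v * (M * R) ^ k / fact k)" if "s \<in> T" for k s
        using L[OF that, of "d k s"] mult_left_mono[OF d_le[OF that] M, of k] by linarith
      show "summable (\<lambda>k. M * (norm v * (M * R) ^ k / fact k))"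
        by (intro summable_mult summable_picard_majorant)
    qed
    moreover have "(\<Sum>i. L s (d i s)) = L s (\<Sum>k. d k s)" if "s \<in> T" for s
      using bounded_linear.suminf[OF lin summable, OF that that] by simp
    ultimately show ?thesis
      by (simp cong: uniform_limit_cong')
  qed
  \<comment> \<open>Derivatives are given only for \<open>d (Suc k)\<close>, so the shifted series
    is differentiated; its derivatives \<open>L s (d k s)\<close> run over all \<open>k\<close>. The
    missing constant \<open>d 0\<close> is restored in \<open>sum_eq\<close>.\<close>
  have "\<exists>g. \<forall>s\<in>T. (\<lambda>k. d (Suc k) s) sums g s \<and>
      (g has_derivative (\<lambda>h. h *\<^sub>R L s (\<Sum>k. d k s))) (at s within T)"
  proof (rule has_derivative_series[OF \<open>convex T\<close>])
    show "(d (Suc k) has_derivative (\<lambda>h. h *\<^sub>R L s (d k s))) (at s within T)" if "s \<in> T" for k s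
      using deriv[OF that] has_derivative_at_withinI unfolding has_vector_derivative_def by blast
    \<comment> \<open>The increment \<open>h\<close> enters only through the factor
      \<open>\<bar>h\<bar>\<close>, so this reduces to \<open>unif\<close>.\<close>
    show "\<forall>\<^sub>F n in sequentially. \<forall>s\<in>T. \<forall>h.
        norm ((\<Sum>i<n. h *\<^sub>R L s (d i s)) - h *\<^sub>R L s (\<Sum>k. d k s)) \<le> e * norm h" if "e > 0" for e
    proof -
      have "\<forall>\<^sub>F n in sequentially. \<forall>s\<in>T. dist (\<Sum>i<n. L s (d i s)) (L s (\<Sum>k. d k s)) < e"
        using unif that by (rule uniform_limitD)
      then show ?thesis
      proof eventually_elim
        case (elim n)
        have "norm ((\<Sum>i<n. h *\<^sub>R L s (d i s)) - h *\<^sub>R L s (\<Sum>k. d k s)) =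
            \<bar>h\<bar> * dist (\<Sum>i<n. L s (d i s)) (L s (\<Sum>k. d k s))" for s h
          by (simp add: dist_norm flip: scaleR_right.sum scaleR_diff_right)
        moreover have "\<bar>h\<bar> * dist (\<Sum>i<n. L s (d i s)) (L s (\<Sum>k. d k s)) \<le> \<bar>h\<bar> * e" if "s \<in> T" for s h
          using elim that by (intro mult_left_mono) (auto intro: less_imp_le)
        ultimately show ?case by (simp add: mult.commute)
      qed
    qed
    show "(\<lambda>k. d (Suc k) t) sums (\<Sum>k. d (Suc k) t)"
      using summable[OF t] summable_Suc_iff[of "\<lambda>k. d k t"] by (intro summable_sums) blast
    show "t \<in> T" by (rule t)
  qed
  then obtain g where g: "\<And>s. s \<in> T \<Longrightarrow> (\<lambda>k. d (Suc k) s) sums g s"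
    "\<And>s. s \<in> T \<Longrightarrow> (g has_vector_derivative L s (\<Sum>k. d k s)) (at s within T)"
    unfolding has_vector_derivative_def by blast
  have sum_eq: "g s + v = (\<Sum>k. d k s)" if "s \<in> T" for s
    using sums_Suc[OF g(1)[OF that]] d0 by (simp add: sums_iff)
  have "((\<lambda>s. g s + v) has_vector_derivative L t (\<Sum>k. d k t)) (at t)"
    using g(2)[OF t] at_within_open[OF t \<open>open T\<close>] by (auto intro!: derivative_eq_intros)
  then show ?thesis
    by (rule has_vector_derivative_transform_within_open[OF _ \<open>open T\<close> t sum_eq])
qed

section \<open>Compact subintervals and matrix bounds\<close>

text \<open>The ends may be infinite and \<open>A\<close> may blow up there, so all estimates are
  made on a compact piece with both points in its interior.\<close>

lemma einterval_subinterval: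
  assumes "s \<in> einterval \<alpha> \<beta>" "t \<in> einterval \<alpha> \<beta>"
  obtains a b :: real where "s \<in> {a<..<b}" "t \<in> {a<..<b}" "{a..b} \<subseteq> einterval \<alpha> \<beta>"
proof -
  have "\<alpha> < ereal (min s t)" "ereal (max s t) < \<beta>"
    using assms by (auto simp: einterval_iff min_def max_def)
  then obtain a b where a: "\<alpha> < ereal a" "ereal a < ereal (min s t)"
    and b: "ereal (max s t) < ereal b" "ereal b < \<beta>"
    using ereal_dense2 by metis
  have "{a..b} \<subseteq> einterval \<alpha> \<beta>"
    using a b unfolding einterval_iff subset_iff atLeastAtMost_iff
    by (meson ereal_less_eq(3) le_less_trans less_le_trans)
  with a b show ?thesis by (intro that[of a b]) auto
qed

lemma bounded_bilinear_matrix_vector_mult: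
  "bounded_bilinear ((*v) :: real ^ 'n ^ 'm \<Rightarrow> real ^ 'n \<Rightarrow> real ^ 'm)"
  unfolding bilinear_conv_bounded_bilinear[symmetric] bilinear_def
  by (intro conjI allI linearI)
    (auto simp: matrix_vector_right_distrib matrix_vector_mult_add_rdistrib
      matrix_vector_mult_scaleR scaleR_matrix_vector_assoc)

text \<open>Compactness bounds \<open>norm (A s)\<close> by some \<open>N\<close>; the constant
  \<open>K\<close> of the bounded bilinear product turns this into a bound on the action on
  vectors.\<close>

lemma norm_matrix_vector_mult_bound_on:
  fixes A :: "real \<Rightarrow> real ^ 'n ^ 'm"
  assumes "continuous_on {a..b} A"
  obtains M where "0 \<le> M" "\<And>s v. s \<in> {a..b} \<Longrightarrow> norm (A s *v v) \<le> M * norm v"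
proof -
  obtain K where K: "0 < K" "\<And>B v. norm ((B :: real ^ 'n ^ 'm) *v v) \<le> norm B * norm v * K"
    using bounded_bilinear.pos_bounded[OF bounded_bilinear_matrix_vector_mult] by blast
  have "bounded (A ` {a..b})"
    by (intro compact_imp_bounded compact_continuous_image assms compact_Icc)
  then obtain N where N: "0 < N" "\<And>s. s \<in> {a..b} \<Longrightarrow> norm (A s) \<le> N"
    unfolding bounded_pos by auto
  show ?thesis
  proof
    show "0 \<le> N * K" using K N by simp
    show "norm (A s *v v) \<le> (N * K) * norm v" if "s \<in> {a..b}" for s v
    proof -
      have "norm (A s *v v) \<le> norm (A s) * (norm v * K)"
        using K(2)[of "A s" v] by (simp add: mult.assoc)
      also have "\<dots> \<le> N * (norm v * K)"
        using N(2)[OF that] K(1) by (intro mult_right_mono) auto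
      finally show ?thesis by (simp add: ac_simps)
    qed
  qed
qed

section \<open>Uniqueness and global existence\<close>

lemma linear_ode_unique:
  fixes A :: "real \<Rightarrow> real ^ 'n ^ 'n"
  assumes A: "continuous_on (einterval \<alpha> \<beta>) A"
    and x: "\<And>t. t \<in> einterval \<alpha> \<beta> \<Longrightarrow> (x has_vector_derivative A t *v x t) (at t)"
    and y: "\<And>t. t \<in> einterval \<alpha> \<beta> \<Longrightarrow> (y has_vector_derivative A t *v y t) (at t)"
    and t\<^sub>0: "t\<^sub>0 \<in> einterval \<alpha> \<beta>" "x t\<^sub>0 = y t\<^sub>0"
    and t: "t \<in> einterval \<alpha> \<beta>"
  shows "x t = y t"
proof -
  obtain a b where ab: "t\<^sub>0 \<in> {a<..<b}" "t \<in> {a<..<b}" "{a..b} \<subseteq> einterval \<alpha> \<beta>"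
    using einterval_subinterval[OF t\<^sub>0(1) t] .
  obtain M where M: "0 \<le> M" "\<And>s v. s \<in> {a..b} \<Longrightarrow> norm (A s *v v) \<le> M * norm v"
    using norm_matrix_vector_mult_bound_on[OF continuous_on_subset[OF A ab(3)]] by blast
  define z where "z s = x s - y s" for s
  have z: "(z has_vector_derivative A s *v z s) (at s)" if "s \<in> {a..b}" for s
    using x[of s] y[of s] ab(3) that unfolding z_def
    by (auto intro!: derivative_eq_intros simp: matrix_vector_mult_diff_distrib)
  \<comment> \<open>The a priori bound \<open>C\<close> that \<open>linear_ode_zero\<close> asks for
    comes from continuity on a compact interval.\<close>
  have "continuous_on {a..b} z"
    using z by (intro continuous_at_imp_continuous_on ballI has_vector_derivative_continuous) auto
  then have "bounded (z ` {a..b})"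
    by (intro compact_imp_bounded compact_continuous_image compact_Icc)
  then obtain C where C: "\<And>s. s \<in> {a..b} \<Longrightarrow> norm (z s) \<le> C"
    unfolding bounded_iff by blast
  have "z t = 0"
    by (rule linear_ode_zero[of "{a..b}" t\<^sub>0 z "\<lambda>s. (*v) (A s)" M C])
      (use ab z M C t\<^sub>0 in \<open>auto simp: z_def\<close>)
  then show ?thesis by (simp add: z_def)
qed

text \<open>The iterates are antiderivatives on the whole interval, so their sum is global from the
  start and nothing has to be continued. Only its derivative is checked locally; there
  \<open>M\<close> may depend on \<open>t\<close>, as it does not enter the series.\<close>

lemma linear_ode_exists:
  fixes A :: "real \<Rightarrow> real ^ 'n ^ 'n"
  assumes A: "continuous_on (einterval \<alpha> \<beta>) A" and t\<^sub>0: "t\<^sub>0 \<in> einterval \<alpha> \<beta>"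
  obtains x where "x t\<^sub>0 = v\<^sub>0"
    "\<And>t. t \<in> einterval \<alpha> \<beta> \<Longrightarrow> (x has_vector_derivative A t *v x t) (at t)"
proof -
  let ?J = "einterval \<alpha> \<beta>"
  have "\<alpha> < \<beta>" using t\<^sub>0 unfolding einterval_iff by (blast intro: less_trans)
  have step: "\<exists>G. (\<forall>t\<in>?J. (G has_vector_derivative A t *v g t) (at t)) \<and> G t\<^sub>0 = 0"
    if g: "continuous_on ?J g" for g
  proof -
    have "continuous_on ?J (\<lambda>t. A t *v g t)"
      by (intro bounded_bilinear.continuous_on[OF bounded_bilinear_matrix_vector_mult] A g)
    then obtain F where F: "\<forall>t\<in>?J. (F has_vector_derivative A t *v g t) (at t)"
      using einterval_antiderivative[OF \<open>\<alpha> < \<beta>\<close>, of "\<lambda>t. A t *v g t"]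
      unfolding continuous_on_eq_continuous_at[OF open_einterval] Ball_def einterval_iff by blast
    show ?thesis
      by (rule exI[of _ "\<lambda>t. F t - F t\<^sub>0"]) (use F in \<open>auto intro!: derivative_eq_intros\<close>)
  qed
  \<comment> \<open>Dependent choice: the invariant carries continuity, which \<open>step\<close>
    needs to produce the next iterate, and fixes the iterate at index 0.\<close>
  obtain d where d: "\<And>k. continuous_on ?J (d k) \<and> (k = 0 \<longrightarrow> d k = (\<lambda>_. v\<^sub>0))"
    "\<And>k. (\<forall>t\<in>?J. (d (Suc k) has_vector_derivative A t *v d k t) (at t)) \<and> d (Suc k) t\<^sub>0 = 0"
  proof (rule dependent_nat_choice[where
      P = "\<lambda>k g. continuous_on ?J g \<and> (k = 0 \<longrightarrow> g = (\<lambda>_. v\<^sub>0))" and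
      Q = "\<lambda>k g G. (\<forall>t\<in>?J. (G has_vector_derivative A t *v g t) (at t)) \<and> G t\<^sub>0 = 0", THEN exE])
    show "\<exists>g. continuous_on ?J g \<and> ((0::nat) = 0 \<longrightarrow> g = (\<lambda>_. v\<^sub>0))"
      by (intro exI[of _ "\<lambda>_. v\<^sub>0"]) auto
    fix g and k :: nat
    assume "continuous_on ?J g \<and> (k = 0 \<longrightarrow> g = (\<lambda>_. v\<^sub>0))"
    with step[of g] obtain G where
      G: "\<forall>t\<in>?J. (G has_vector_derivative A t *v g t) (at t)" "G t\<^sub>0 = 0" by blast
    then have "continuous_on ?J G"
      by (intro continuous_at_imp_continuous_on ballI has_vector_derivative_continuous) blast
    with G show "\<exists>G. (continuous_on ?J G \<and> (Suc k = 0 \<longrightarrow> G = (\<lambda>_. v\<^sub>0))) \<and>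
        (\<forall>t\<in>?J. (G has_vector_derivative A t *v g t) (at t)) \<and> G t\<^sub>0 = 0" by blast
  qed blast
  have d0: "d 0 = (\<lambda>_. v\<^sub>0)" and dt\<^sub>0: "\<And>k. d (Suc k) t\<^sub>0 = 0"
    using d by blast+
  show ?thesis
  proof
    have "d k t\<^sub>0 = 0" if "k \<noteq> 0" for k
      using dt\<^sub>0 that by (cases k) auto
    then show "(\<Sum>k. d k t\<^sub>0) = v\<^sub>0"
      using suminf_finite[of "{0}" "\<lambda>k. d k t\<^sub>0"] d0 by simp
    fix t assume t: "t \<in> ?J"
    obtain a b where ab: "t\<^sub>0 \<in> {a<..<b}" "t \<in> {a<..<b}" "{a..b} \<subseteq> ?J"
      using einterval_subinterval[OF t\<^sub>0 t] .
    obtain M where M: "0 \<le> M" "\<And>s v. s \<in> {a..b} \<Longrightarrow> norm (A s *v v) \<le> M * norm v"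
      using norm_matrix_vector_mult_bound_on[OF continuous_on_subset[OF A ab(3)]] by blast
    show "((\<lambda>t. \<Sum>k. d k t) has_vector_derivative A t *v (\<Sum>k. d k t)) (at t)"
    proof (rule picard_series_has_vector_derivative[of "{a<..<b}" t\<^sub>0 d "\<lambda>s. (*v) (A s)" M v\<^sub>0])
      show "(d (Suc k) has_vector_derivative A s *v d k s) (at s)" if "s \<in> {a<..<b}" for k s
        using d(2)[of k] ab(3) that by (auto simp: subset_iff)
    qed (use ab M d0 dt\<^sub>0 in auto)
  qed
qed

section \<open>Smoothness of solutions\<close>

text \<open>Finite differentiability classes, unfolded from the first derivative so that induction applies.\<close>

primrec Ck_on :: "nat \<Rightarrow> real set \<Rightarrow> (real \<Rightarrow> 'a::real_normed_vector) \<Rightarrow> bool" where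
  "Ck_on 0 S f \<longleftrightarrow> (\<forall>t\<in>S. f differentiable (at t))"
| "Ck_on (Suc k) S f \<longleftrightarrow> (\<forall>t\<in>S. f differentiable (at t)) \<and> Ck_on k S (\<lambda>s. vector_derivative f (at s))"

text \<open>Index 0 already demands differentiability, so \<open>Ck_on k\<close> concerns
  derivatives up to order \<open>k + 1\<close>. The recursion differentiates first and then
  iterates, which matches \<open>funpow_Suc_right\<close>.\<close>

lemma Ck_on_iff:
  "Ck_on k S f \<longleftrightarrow>
     (\<forall>j\<le>k. \<forall>t\<in>S. ((\<lambda>g s. vector_derivative g (at s)) ^^ j) f differentiable (at t))"
proof (induction k arbitrary: f)
  case (Suc k)
  have *: "(\<forall>j\<le>Suc k. P j) \<longleftrightarrow> P 0 \<and> (\<forall>j\<le>k. P (Suc j))" for P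
    by (metis Suc_le_mono not0_implies_Suc zero_le)
  show ?case
    unfolding * by (simp add: Suc funpow_Suc_right del: funpow.simps(2))
qed simp

lemma smooth_on_iff_Ck_on: "smooth_on S f \<longleftrightarrow> (\<forall>k. Ck_on k S f)"
  unfolding smooth_on_def Ck_on_iff by blast

lemma Ck_on_differentiable: "Ck_on k S f \<Longrightarrow> t \<in> S \<Longrightarrow> f differentiable (at t)"
  by (cases k) auto

lemma Ck_on_SucD: "Ck_on (Suc k) S f \<Longrightarrow> Ck_on k S f"
  unfolding Ck_on_iff by simp

lemma has_vector_derivative_cong_open:
  assumes "open S" "\<And>s. s \<in> S \<Longrightarrow> f s = g s" "f differentiable (at t)" "t \<in> S"
  shows "(g has_vector_derivative vector_derivative f (at t)) (at t)"
  by (rule has_vector_derivative_transform_within_open[OF _ assms(1,4,2)])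
    (simp_all add: assms(3) flip: vector_derivative_works)

lemma Ck_on_cong:
  assumes "open S" "\<And>t. t \<in> S \<Longrightarrow> f t = g t" "Ck_on k S f"
  shows "Ck_on k S g"
  using assms(2,3)
proof (induction k arbitrary: f g)
  case 0
  then show ?case
    using has_vector_derivative_cong_open[OF \<open>open S\<close>, of f g] differentiableI_vector
    unfolding Ck_on.simps by blast
next
  case (Suc k)
  have g: "(g has_vector_derivative vector_derivative f (at t)) (at t)" if "t \<in> S" for t
    using has_vector_derivative_cong_open[OF \<open>open S\<close>, of f g] Suc.prems that
    unfolding Ck_on.simps by blast
  have "Ck_on k S (\<lambda>s. vector_derivative g (at s))"
  proof (rule Suc.IH)
    show "Ck_on k S (\<lambda>s. vector_derivative f (at s))" using Suc.prems(2) by simp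
  qed (simp add: vector_derivative_at[OF g])
  with g show ?case
    using differentiableI_vector unfolding Ck_on.simps by blast
qed

text \<open>Derivatives are usually known only on \<open>S\<close>; by \<open>Ck_on_cong\<close>,
  the values of \<open>vector_derivative\<close> elsewhere do not matter.\<close>

lemma Ck_on_SucI:
  assumes "open S" "\<And>t. t \<in> S \<Longrightarrow> (f has_vector_derivative f' t) (at t)" "Ck_on k S f'"
  shows "Ck_on (Suc k) S f"
proof -
  have "Ck_on k S (\<lambda>s. vector_derivative f (at s))"
    by (rule Ck_on_cong[OF assms(1) _ assms(3)]) (simp add: vector_derivative_at[OF assms(2)])
  then show ?thesis
    using assms(2) by (auto intro: differentiableI_vector)
qed

lemma Ck_on_add:
  assumes "open S" "Ck_on k S f" "Ck_on k S g"
  shows "Ck_on k S (\<lambda>t. f t + g t)"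
  using assms(2,3)
proof (induction k arbitrary: f g)
  case (Suc k)
  show ?case
  proof (rule Ck_on_SucI[OF \<open>open S\<close>])
    show "((\<lambda>t. f t + g t) has_vector_derivative
        vector_derivative f (at t) + vector_derivative g (at t)) (at t)" if "t \<in> S" for t
      using Suc.prems that by (intro has_vector_derivative_add) (auto simp: vector_derivative_works)
  qed (use Suc in auto)
qed auto

text \<open>By the product rule the derivative is a sum of two terms of the same bilinear shape,
  with factors of class \<open>k\<close>, so the induction hypothesis and \<open>Ck_on_add\<close>
  apply.\<close>

lemma Ck_on_bilinear:
  assumes bl: "bounded_bilinear p" and "open S" "Ck_on k S f" "Ck_on k S g"
  shows "Ck_on k S (\<lambda>t. p (f t) (g t))"
  using assms(3,4)
proof (induction k arbitrary: f g)
  case 0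
  then show ?case
    by (auto dest!: bspec simp: vector_derivative_works[of f] vector_derivative_works[of g]
        intro!: differentiableI_vector bounded_bilinear.has_vector_derivative[OF bl])
next
  case (Suc k)
  show ?case
  proof (rule Ck_on_SucI[OF \<open>open S\<close>])
    show "((\<lambda>t. p (f t) (g t)) has_vector_derivative
        p (f t) (vector_derivative g (at t)) + p (vector_derivative f (at t)) (g t)) (at t)"
      if "t \<in> S" for t
      using Suc.prems that
      by (intro bounded_bilinear.has_vector_derivative[OF bl]) (auto simp: vector_derivative_works)
  next
    show "Ck_on k S (\<lambda>t. p (f t) (vector_derivative g (at t)) + p (vector_derivative f (at t)) (g t))"
      using Suc.prems by (intro Ck_on_add \<open>open S\<close> Suc.IH) (auto dest: Ck_on_SucD simp del: Ck_on.simps, auto)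
  qed
qed

text \<open>If \<open>x\<close> has class \<open>k\<close>, so does the product
  \<open>A t *v x t\<close>; this is the derivative of \<open>x\<close>, so \<open>x\<close> gains
  one order.\<close>

lemma smooth_on_linear_ode_solution:
  fixes A :: "real \<Rightarrow> real ^ 'n ^ 'n"
  assumes "open S" "smooth_on S A"
    and x: "\<And>t. t \<in> S \<Longrightarrow> (x has_vector_derivative A t *v x t) (at t)"
  shows "smooth_on S x"
proof -
  have "Ck_on k S x" for k
  proof (induction k)
    case 0
    then show ?case using x by (auto intro: differentiableI_vector)
  next
    case (Suc k)
    have "Ck_on k S (\<lambda>t. A t *v x t)"
      using assms(2) Suc
      by (intro Ck_on_bilinear[OF bounded_bilinear_matrix_vector_mult \<open>open S\<close>])
        (auto simp: smooth_on_iff_Ck_on)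
    with x show ?case by (rule Ck_on_SucI[OF \<open>open S\<close>])
  qed
  then show ?thesis by (simp add: smooth_on_iff_Ck_on)
qed

theorem corollary3p2:
  fixes \<alpha> \<beta> :: ereal
    and A :: "real \<Rightarrow> real ^ 'n ^ 'n"
    and J :: "real set"
    and t\<^sub>0 :: real
    and v\<^sub>0 :: "real ^ 'n"
  assumes J: "J = einterval \<alpha> \<beta>"
    and A: "smooth_on J A"
    and t\<^sub>0: "t\<^sub>0 \<in> J"
  shows "\<exists>!x :: real \<Rightarrow> real ^ 'n. x \<in> extensional J \<and> smooth_on J x \<and>
           (\<forall>t\<in>J. (x has_vector_derivative A t *v x t) (at t)) \<and> x t\<^sub>0 = v\<^sub>0"
proof -
  have "open J" by (simp add: J)
  have cont: "continuous_on J A"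
    using A Ck_on_differentiable[of 0 J A] unfolding smooth_on_iff_Ck_on
    by (intro continuous_at_imp_continuous_on ballI differentiable_imp_continuous_within) blast
  obtain x where x: "x t\<^sub>0 = v\<^sub>0" "\<And>t. t \<in> J \<Longrightarrow> (x has_vector_derivative A t *v x t) (at t)"
    using linear_ode_exists[OF cont[unfolded J] t\<^sub>0[unfolded J]] unfolding J by blast
  \<comment> \<open>A solution matters only on \<open>J\<close>; \<open>restrict\<close> selects the
    representative that is \<open>undefined\<close> outside, which makes uniqueness hold for total
    functions. Derivatives on the open set \<open>J\<close> are unaffected.\<close>
  have deriv: "(restrict x J has_vector_derivative A t *v restrict x J t) (at t)" if "t \<in> J" for t
    using has_vector_derivative_transform_within_open[OF x(2)[OF that] \<open>open J\<close> that, of "restrict x J"] that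
    by simp
  show ?thesis
  proof (rule ex1I[of _ "restrict x J"])
    show "restrict x J \<in> extensional J \<and> smooth_on J (restrict x J) \<and>
        (\<forall>t\<in>J. (restrict x J has_vector_derivative A t *v restrict x J t) (at t)) \<and>
        restrict x J t\<^sub>0 = v\<^sub>0"
      using deriv smooth_on_linear_ode_solution[OF \<open>open J\<close> A deriv] t\<^sub>0 x(1) by auto
    fix y
    assume y: "y \<in> extensional J \<and> smooth_on J y \<and>
        (\<forall>t\<in>J. (y has_vector_derivative A t *v y t) (at t)) \<and> y t\<^sub>0 = v\<^sub>0"
    show "y = restrict x J"
    proof (rule extensionalityI)
      show "y t = restrict x J t" if "t \<in> J" for t
        using linear_ode_unique[OF cont[unfolded J], of y x t\<^sub>0 t] y x t\<^sub>0 that by (auto simp: J)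
    qed (use y in auto)
  qed
qed

end
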